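(* Let $\mathcal{G}=(\mathcal{V},\mathcal{E})$ be a directed graph with $n$ nodes $v_1,\dots,v_n$, and let $\langle v_{i_1}|v_{i_2}|\dots|v_{i_r}\rangle$, $r\ge 2$, be a simple directed path in $\mathcal{G}$ from $v_{i_1}$ to $v_{i_r}$. Let $j_k\in\mathcal{I}(i_k)$, $k=1,\dots,r$, be any choice of indices. For $k=1,\dots,r-1$ let $f_{j_k}:\mathbb{R}^{|\mathcal{I}(j_k)|}\times\mathbb{R}^{|\mathcal{I}(j_{k+1})|}\to\mathbb{R}$ be of class $\mathcal{C}^1$ and define the vector field $h_{j_{k+1},j_k}(z)=e_{j_k}\,f_{j_k}(z_{\mathcal{I}(j_k)},z_{\mathcal{I}(j_{k+1})})$ on $\mathbb{R}^N$. Suppose that $$f_{j_k}(z_{\mathcal{I}(j_k)},z_{\mathcal{I}(j_{k+1})})=f_{j_k}^{(1)}(z_{\mathcal{I}(j_k)})\,f_{j_k}^{(2)}(z_{\mathcal{I}(j_{k+1})}),\qquad k=1,\dots,r-1,$$ for real-valued functions $f_{j_k}^{(1)},f_{j_k}^{(2)}$ such that $$f_{j_k}^{(1)}(z_{\mathcal{I}(j_k)})\,\frac{\partial f_{j_{k-1}}^{(2)}}{\partial z_{j_k}}(z_{\mathcal{I}(j_k)})=1$$ for all $z_{\mathcal{I}(j_k)}\in\mathbb{R}^{|\mathcal{I}(j_k)|}$ and all $k=2,3,\dots,r-1$. Then, for all $z\in\mathbb{R}^N$, $$\Big[h_{j_r,j_{r-1}},\big[h_{j_{r-1},j_{r-2}},[\dots,[h_{j_3,j_2},h_{j_2,j_1}]\dots]\big]\Big](z)=e_{j_1}\,f_{j_1}^{(1)}(z_{\mathcal{I}(j_1)})\,f_{j_{r-1}}^{(2)}(z_{\mathcal{I}(j_r)}),$$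 and the left-hand side is a Lie bracket of admissible vector fields (i.e. each $h_{j_{k+1},j_k}$, $k=1,\dots,r-1$, is admissible).
   Context: State and index sets. Agents are the nodes $v_1,\dots,v_n$ of $\mathcal{G}$. Agent $i$ has $p_i\ge 0$ associated equality-constraint multipliers and $q_i\ge 0$ associated inequality-constraint multipliers. Put $p=\sum_i p_i$, $q=\sum_i q_i$, $N=n+p+q$. The complete state is $z=[x^\top,\nu^\top,\lambda^\top]^\top\in\mathbb{R}^N$ with $x\in\mathbb{R}^n$, $\nu\in\mathbb{R}^p$, $\lambda\in\mathbb{R}^q$. For $i=1,\dots,n$ let $$\bar{\mathcal{I}}(i)=\{i\}\cup\{n+\textstyle\sum_{k=1}^{i-1}p_k+\ell:\ \ell=1,\dots,p_i\}\cup\{n+p+\sum_{k=1}^{i-1}q_k+\ell:\ \ell=1,\dots,q_i\},$$ the set of indices of components of $z$ belonging to agent $i$. These sets partition $\{1,\dots,N\}$. For $j\in\{1,\dots,N\}$, $\mathcal{I}(j):=\bar{\mathcal{I}}(i)$ where $i$ is the agent with $j\in\bar{\mathcal{I}}(i)$; in particular $\mathcal{I}(i)=\bar{\mathcal{I}}(i)$ for $i\le n$. For $\mathcal{S}\subseteq\{1,\dots,N\}$, $z_{\mathcal{S}}\in\mathbb{R}^{|\mathcal{S}|}$ is the ordered stacked vector of the $z_s$, $s\in\mathcal{S}$. $e_j\in\mathbb{R}^N$ is the $j$th unit vector. Graph. An edge $(v_i,v_j)\in\mathcal{E}$ means that agent $i$ receives information from agent $j$. A directed path $\langle v_{i_1}|\dots|v_{i_r}\rangle$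 is a sequence of nodes with $(v_{i_k},v_{i_{k+1}})\in\mathcal{E}$ for all $k$; it is simple if no node occurs more than once. Admissibility. A vector field on $\mathbb{R}^N$ is admissible if it can be computed locally by the agents: each component with index in $\bar{\mathcal{I}}(k)$ depends only on $z_{\bar{\mathcal{I}}(k)}$ and on $z_{\bar{\mathcal{I}}(\ell)}$ for those $\ell$ with $(v_k,v_\ell)\in\mathcal{E}$. Lie bracket. $[f_1,f_2](z)=\frac{\partial f_2}{\partial z}(z)f_1(z)-\frac{\partial f_1}{\partial z}(z)f_2(z)$. For $r=2$ the iterated bracket is just $h_{j_2,j_1}$. *)

theory Defs
  imports "HOL-Analysis.Analysis" "Graph_Theory.Graph_Theory"
begin

text \<open>
  The dimension of the state space and the dimensions of the blocks of the state vary with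
  the parameters, so coordinate spaces are carriers rather than types: for a finite set \<open>S\<close> of
  indices, \<open>\<real>\<^sup>S\<close> is the set of functions that are \<open>undefined\<close> outside \<open>S\<close>, with the product
  topology \<open>powertop_real S\<close>.  The state space is the case \<open>S = {1..N}\<close>, and the subvector
  \<open>z\<^sub>S\<close> of a state \<open>z\<close> is \<open>restrict z S\<close>; its entries keep their global indices, so that the
  partial derivatives of a function of \<open>z\<^sub>S\<close> are those in the directions \<open>s \<in> S\<close>.
\<close>

type_synonym coords = "nat \<Rightarrow> real"
type_synonym vfield = "coords \<Rightarrow> coords"

abbreviation coord_space :: "nat set \<Rightarrow> coords set" where
  "coord_space S \<equiv> S \<rightarrow>\<^sub>E UNIV"


subsection \<open>Differentiation in coordinates\<close>

definition has_partial :: "(coords \<Rightarrow> real) \<Rightarrow> nat \<Rightarrow> coords \<Rightarrow> bool" where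
  "has_partial g s y \<longleftrightarrow> (\<lambda>t. g (y(s := t))) field_differentiable at (y s)"

definition partial :: "(coords \<Rightarrow> real) \<Rightarrow> nat \<Rightarrow> coords \<Rightarrow> real" where
  "partial g s y = deriv (\<lambda>t. g (y(s := t))) (y s)"

definition C1_on_prod :: "nat set \<Rightarrow> nat set \<Rightarrow> (coords \<Rightarrow> coords \<Rightarrow> real) \<Rightarrow> bool" where
  "C1_on_prod S T f \<longleftrightarrow>
     (\<forall>s\<in>S. (\<forall>y\<in>coord_space S. \<forall>w\<in>coord_space T. has_partial (\<lambda>u. f u w) s y) \<and>
        continuous_map (prod_topology (powertop_real S) (powertop_real T)) euclideanreal
          (\<lambda>(y, w). partial (\<lambda>u. f u w) s y)) \<and>
     (\<forall>s\<in>T. (\<forall>y\<in>coord_space S. \<forall>w\<in>coord_space T. has_partial (f y) s w) \<and>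
        continuous_map (prod_topology (powertop_real S) (powertop_real T)) euclideanreal
          (\<lambda>(y, w). partial (f y) s w))"

text \<open>Both terms are products of a Jacobian matrix with a vector.\<close>

definition lie_bracket :: "nat \<Rightarrow> vfield \<Rightarrow> vfield \<Rightarrow> vfield" where
  "lie_bracket N F1 F2 z =
     (\<lambda>i\<in>{1..N}. (\<Sum>j=1..N. partial (\<lambda>w. F2 w i) j z * F1 z j)
                 - (\<Sum>j=1..N. partial (\<lambda>w. F1 w i) j z * F2 z j))"

text \<open>\<open>[X\<^sub>1, [X\<^sub>2, [\<dots>, [X\<^sub>m\<^sub>-\<^sub>1, X\<^sub>m] \<dots>]]]\<close>, which is \<open>X\<^sub>1\<close> for a one-element list; the empty
  list is left unspecified.\<close>

fun nested_bracket :: "nat \<Rightarrow> vfield list \<Rightarrow> vfield" where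
  "nested_bracket N [X] = X"
| "nested_bracket N (X # Y # Xs) = lie_bracket N X (nested_bracket N (Y # Xs))"


subsection \<open>Agents and their components of the state\<close>

definition total_dim :: "nat \<Rightarrow> (nat \<Rightarrow> nat) \<Rightarrow> (nat \<Rightarrow> nat) \<Rightarrow> nat" where
  "total_dim n p q = n + (\<Sum>k=1..n. p k) + (\<Sum>k=1..n. q k)"

definition agent_indices :: "nat \<Rightarrow> (nat \<Rightarrow> nat) \<Rightarrow> (nat \<Rightarrow> nat) \<Rightarrow> nat \<Rightarrow> nat set" where
  "agent_indices n p q i =
     {i} \<union> {n + (\<Sum>k\<in>{1..<i}. p k) + l | l. l \<in> {1..p i}}
         \<union> {n + (\<Sum>k=1..n. p k) + (\<Sum>k\<in>{1..<i}. q k) + l | l. l \<in> {1..q i}}"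

definition index_set :: "nat \<Rightarrow> (nat \<Rightarrow> nat) \<Rightarrow> (nat \<Rightarrow> nat) \<Rightarrow> nat \<Rightarrow> nat set" where
  "index_set n p q j =
     agent_indices n p q (THE i. i \<in> {1..n} \<and> j \<in> agent_indices n p q i)"

text \<open>The arc \<open>(k, l)\<close> means that agent \<open>k\<close> receives information from agent \<open>l\<close>.\<close>

definition admissible ::
    "nat pair_pre_digraph \<Rightarrow> nat \<Rightarrow> (nat \<Rightarrow> nat) \<Rightarrow> (nat \<Rightarrow> nat) \<Rightarrow> vfield \<Rightarrow> bool" where
  "admissible G n p q F \<longleftrightarrow>
     F \<in> coord_space {1..total_dim n p q} \<rightarrow> coord_space {1..total_dim n p q} \<and>
     (\<forall>k\<in>{1..n}. \<forall>j\<in>agent_indices n p q k.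
        \<forall>z\<in>coord_space {1..total_dim n p q}. \<forall>z'\<in>coord_space {1..total_dim n p q}.
          (\<forall>l. l = k \<or> (k, l) \<in> parcs G \<longrightarrow>
             restrict z (agent_indices n p q l) = restrict z' (agent_indices n p q l)) \<longrightarrow>
          F z j = F z' j)"


subsection \<open>Vector fields along edges\<close>

text \<open>The vector \<open>a e\<^sub>j\<close> in \<open>\<real>\<^sup>N\<close>, for a scalar \<open>a\<close> and the unit vector \<open>e\<^sub>j\<close>.\<close>

definition scaled_unit :: "nat \<Rightarrow> nat \<Rightarrow> real \<Rightarrow> coords" where
  "scaled_unit N j a = (\<lambda>m\<in>{1..N}. if m = j then a else 0)"

text \<open>The field \<open>h\<^sub>j\<^sub>'\<^sub>,\<^sub>j\<close>; the index \<open>j'\<close> of the sending component comes first.\<close>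

definition edge_field :: "nat \<Rightarrow> (nat \<Rightarrow> nat) \<Rightarrow> (nat \<Rightarrow> nat) \<Rightarrow> nat \<Rightarrow> nat \<Rightarrow>
    (coords \<Rightarrow> coords \<Rightarrow> real) \<Rightarrow> vfield" where
  "edge_field n p q j' j f z =
     scaled_unit (total_dim n p q) j
       (f (restrict z (index_set n p q j)) (restrict z (index_set n p q j')))"

end

theory Submission
  imports Defs
begin

text \<open>
  By induction on \<open>m\<close>, the bracket of the first \<open>m\<close> fields is
  \<open>e\<^bsub>j 1\<^esub> f1 1 f2 m\<close>, the case \<open>m = 1\<close> being the factorisation of \<open>f 1\<close>.  Bracketing this
  with \<open>h (m + 1) = e\<^bsub>j (m+1)\<^esub> f1 (m + 1) f2 (m + 1)\<close> leaves a single term: since the path is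
  simple and the blocks of different agents are disjoint, \<open>h (m + 1)\<close> does not depend on
  the component \<open>j 1\<close>, and only the factor \<open>f2 m\<close> of \<open>e\<^bsub>j 1\<^esub> f1 1 f2 m\<close> depends on the component
  \<open>j (m + 1)\<close>.  Its derivative cancels against \<open>f1 (m + 1)\<close> by hypothesis.
\<close>

section \<open>Partial derivatives on coordinate carriers\<close>

lemma coord_space_upd: "z \<in> coord_space S \<Longrightarrow> s \<in> S \<Longrightarrow> z(s := t) \<in> coord_space S"
  by (auto simp: PiE_iff extensional_def)

text \<open>The line \<open>z(s := t)\<close> never leaves the carrier, so agreement there
  suffices.\<close>

lemma partial_cong:
  assumes "\<And>w. w \<in> coord_space S \<Longrightarrow> g w = g' w" "z \<in> coord_space S" "s \<in> S"
  shows "partial g s z = partial g' s z"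
  using assms by (simp add: partial_def coord_space_upd)

lemma partial_const [simp]: "partial (\<lambda>w. c) s z = 0"
  by (simp add: partial_def)

lemma restrict_upd_in: "s \<in> S \<Longrightarrow> restrict (z(s := t)) S = (restrict z S)(s := t)"
  by (auto simp: fun_eq_iff)

lemma restrict_upd_notin: "s \<notin> S \<Longrightarrow> restrict (z(s := t)) S = restrict z S"
  by (auto simp: fun_eq_iff)

lemma partial_restrict_notin:
  assumes "s \<notin> S" "s \<notin> T"
  shows "partial (\<lambda>w. g (restrict w S) (restrict w T)) s z = 0"
  using assms by (simp add: partial_def restrict_upd_notin)

text \<open>Moving coordinate \<open>s\<close> leaves the factor \<open>a\<close> fixed, as
  \<open>s \<notin> S\<close>; \<open>has_partial\<close> then allows this constant to be pulled out
  of \<open>deriv\<close>.\<close>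

lemma partial_mult_restrict:
  assumes "s \<notin> S" "s \<in> T" "has_partial b s (restrict z T)"
  shows "partial (\<lambda>w. a (restrict w S) * b (restrict w T)) s z
    = a (restrict z S) * partial b s (restrict z T)"
  using assms unfolding partial_def has_partial_def
  by (simp add: restrict_upd_in restrict_upd_notin)

lemma sum_scaled_unit:
  assumes "a \<in> {1..N}"
  shows "(\<Sum>k=1..N. g k * scaled_unit N a c k) = g a * c"
proof -
  have "(\<Sum>k=1..N. g k * scaled_unit N a c k) = (\<Sum>k=1..N. if k = a then g k * c else 0)"
    by (rule sum.cong) (auto simp: scaled_unit_def)
  then show ?thesis
    using assms by simp
qed

text \<open>Each Jacobian has a single nonzero row and is applied to a multiple of a unit vector, so
  each sum keeps one entry; \<open>indep\<close> kills the entry of the second sum. The shapes of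
  \<open>F1\<close> and \<open>F2\<close> are required only on the carrier, which is where the
  induction hypothesis of the theorem provides them.\<close>

lemma lie_bracket_scaled_unit:
  assumes F1: "\<And>w. w \<in> coord_space {1..N} \<Longrightarrow> F1 w = scaled_unit N a (\<alpha> w)"
    and F2: "\<And>w. w \<in> coord_space {1..N} \<Longrightarrow> F2 w = scaled_unit N b (\<beta> w)"
    and ab: "a \<in> {1..N}" "b \<in> {1..N}" and z: "z \<in> coord_space {1..N}"
    and indep: "partial \<alpha> b z = 0"
  shows "lie_bracket N F1 F2 z = scaled_unit N b (partial \<beta> a z * \<alpha> z)"
proof -
  have comp: "partial (\<lambda>w. F w m) s z = (if m = c then partial \<gamma> s z else 0)"
    if "\<And>w. w \<in> coord_space {1..N} \<Longrightarrow> F w = scaled_unit N c (\<gamma> w)" "m \<in> {1..N}" "s \<in> {1..N}"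
    for F c \<gamma> m s
  proof -
    have "partial (\<lambda>w. F w m) s z = partial (\<lambda>w. if m = c then \<gamma> w else 0) s z"
      using that z by (intro partial_cong[where S = "{1..N}"]) (auto simp: scaled_unit_def)
    then show ?thesis
      by simp
  qed
  have "(\<Sum>s=1..N. partial (\<lambda>w. F2 w m) s z * F1 z s)
      - (\<Sum>s=1..N. partial (\<lambda>w. F1 w m) s z * F2 z s)
      = (if m = b then partial \<beta> a z * \<alpha> z else 0)" if "m \<in> {1..N}" for m
    using that ab comp[OF F1 that ab(2)] comp[OF F2 that ab(1)] indep
    unfolding F1[OF z] F2[OF z] by (simp only: sum_scaled_unit) simp
  then show ?thesis
    by (auto simp: lie_bracket_def scaled_unit_def)
qed

section \<open>Disjointness of the index blocks of different agents\<close>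

lemma prefix_sum_inj:
  fixes p :: "nat \<Rightarrow> nat"
  assumes "(\<Sum>k\<in>{1..<a}. p k) + l = (\<Sum>k\<in>{1..<b}. p k) + l'"
    and "l \<in> {1..p a}" "l' \<in> {1..p b}" "a \<ge> 1" "b \<ge> 1"
  shows "a = b"
proof -
  have less: "(\<Sum>k\<in>{1..<c}. p k) + p c \<le> (\<Sum>k\<in>{1..<d}. p k)" if "c < d" "c \<ge> 1" for c d
  proof -
    have "(\<Sum>k\<in>{1..<c}. p k) + p c = (\<Sum>k\<in>{1..<Suc c}. p k)"
      using that by simp
    also have "\<dots> \<le> (\<Sum>k\<in>{1..<d}. p k)"
      using that by (intro sum_mono2) auto
    finally show ?thesis .
  qed
  \<comment> \<open>If \<open>a < b\<close>, then \<open>l \<le> p a\<close> bounds the left side by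
    the prefix sum up to \<open>b\<close>, and \<open>l' \<ge> 1\<close> puts the right side
    strictly above it; \<open>b < a\<close> is symmetric.\<close>
  show ?thesis
    using less[of a b] less[of b a] assms by (cases a b rule: linorder_cases) auto
qed

lemma prefix_sum_le:
  fixes p :: "nat \<Rightarrow> nat"
  assumes "a \<in> {1..n}" "l \<in> {1..p a}"
  shows "(\<Sum>k\<in>{1..<a}. p k) + l \<le> (\<Sum>k=1..n. p k)"
proof -
  have "(\<Sum>k\<in>{1..<a}. p k) + l \<le> (\<Sum>k\<in>{1..<Suc a}. p k)"
    using assms by simp
  also have "\<dots> \<le> (\<Sum>k=1..n. p k)"
    using assms by (intro sum_mono2) auto
  finally show ?thesis .
qed

lemma agent_indices_subset:
  assumes "a \<in> {1..n}"
  shows "agent_indices n p q a \<subseteq> {1..total_dim n p q}"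
  using assms prefix_sum_le[OF assms, of _ p] prefix_sum_le[OF assms, of _ q]
  by (fastforce simp: agent_indices_def total_dim_def)

text \<open>Each case also records the range of \<open>s\<close>. The three ranges are disjoint and
  do not mention \<open>a\<close>, so an index shared by two agents falls into the same case for
  both.\<close>

lemma agent_indices_cases:
  assumes "s \<in> agent_indices n p q a" "a \<in> {1..n}"
  obtains (state) "s = a" "s \<le> n"
  | (eq_mult) l where "s = n + ((\<Sum>k\<in>{1..<a}. p k) + l)" "l \<in> {1..p a}"
      "n < s" "s \<le> n + (\<Sum>k=1..n. p k)"
  | (ineq_mult) l where "s = n + (\<Sum>k=1..n. p k) + ((\<Sum>k\<in>{1..<a}. q k) + l)" "l \<in> {1..q a}"
      "n + (\<Sum>k=1..n. p k) < s"
  using assms prefix_sum_le[OF assms(2), of _ p]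
  unfolding agent_indices_def by fastforce

lemma agent_indices_unique:
  assumes "s \<in> agent_indices n p q a" "s \<in> agent_indices n p q b" "a \<in> {1..n}" "b \<in> {1..n}"
  shows "a = b"
  using assms(1,3)
proof (cases rule: agent_indices_cases)
  case state
  note s = this
  show ?thesis using assms(2,4) by (cases rule: agent_indices_cases) (use s in auto)
next
  case (eq_mult l)
  note s = this
  show ?thesis using assms(2,4)
  proof (cases rule: agent_indices_cases)
    case (eq_mult l')
    then show ?thesis using s assms(3,4) prefix_sum_inj[of p a l b l'] by simp
  qed (use s in auto)
next
  case (ineq_mult l)
  note s = this
  show ?thesis using assms(2,4)
  proof (cases rule: agent_indices_cases)
    case (ineq_mult l')
    then show ?thesis using s assms(3,4) prefix_sum_inj[of q a l b l'] by simp
  qed (use s in auto)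
qed

lemma index_set_eq:
  assumes "s \<in> agent_indices n p q a" "a \<in> {1..n}"
  shows "index_set n p q s = agent_indices n p q a"
proof -
  have "(THE i. i \<in> {1..n} \<and> s \<in> agent_indices n p q i) = a"
    using assms agent_indices_unique by (intro the_equality) blast+
  then show ?thesis
    by (simp add: index_set_def)
qed

lemma index_set_agent: "a \<in> {1..n} \<Longrightarrow> index_set n p q a = agent_indices n p q a"
  by (rule index_set_eq) (simp_all add: agent_indices_def)

section \<open>Arcs of the path and admissibility of the edge fields\<close>

lemma vwalk_arcs_map_upt:
  "a \<le> k \<Longrightarrow> k < b \<Longrightarrow> (i k, i (Suc k)) \<in> set (vwalk_arcs (map i [a..<Suc b]))"
proof (induction "b - a" arbitrary: a)
  case 0
  then show ?case by simp
next
  case (Suc d)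
  \<comment> \<open>Two leading elements must be visible before \<open>vwalk_arcs\<close> can split
    off the arc at \<open>a\<close>.\<close>
  have "[a..<Suc b] = a # Suc a # [Suc (Suc a)..<Suc b]" "[Suc a..<Suc b] = Suc a # [Suc (Suc a)..<Suc b]"
    using Suc.prems by (simp_all add: upt_rec)
  then show ?case
    using Suc.hyps(1)[of "Suc a"] Suc.hyps(2) Suc.prems by (cases "a = k") auto
qed

text \<open>Only component \<open>s\<close> varies with the state. Its owner is \<open>a\<close>
  alone, and it reads the blocks of \<open>a\<close> and of \<open>b\<close>, the latter permitted
  by the arc \<open>(a, b)\<close>.\<close>

lemma admissible_edge_field:
  assumes "a \<in> {1..n}" "b \<in> {1..n}" "(a, b) \<in> parcs G"
    and "s \<in> agent_indices n p q a" "s' \<in> agent_indices n p q b"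
  shows "admissible G n p q (edge_field n p q s' s g)"
  unfolding admissible_def
proof (intro conjI ballI impI)
  show "edge_field n p q s' s g
      \<in> coord_space {1..total_dim n p q} \<rightarrow> coord_space {1..total_dim n p q}"
    by (auto simp: edge_field_def scaled_unit_def)
next
  fix k m and z z' :: coords
  assume k: "k \<in> {1..n}" and m: "m \<in> agent_indices n p q k"
    and eq: "\<forall>l. l = k \<or> (k, l) \<in> parcs G \<longrightarrow>
      restrict z (agent_indices n p q l) = restrict z' (agent_indices n p q l)"
  show "edge_field n p q s' s g z m = edge_field n p q s' s g z' m"
  proof (cases "m = s")
    case True
    then have "k = a"
      using agent_indices_unique assms k m by blast
    then show ?thesis
      using eq assms by (simp add: edge_field_def index_set_eq[of s n p q a] index_set_eq[of s' n p q b])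
  next
    case False
    then show ?thesis
      by (simp add: edge_field_def scaled_unit_def restrict_def)
  qed
qed

theorem proposition1:
  fixes G :: "nat pair_pre_digraph"
    and n r :: nat
    and p q :: "nat \<Rightarrow> nat"
    and i j :: "nat \<Rightarrow> nat"
    and f :: "nat \<Rightarrow> coords \<Rightarrow> coords \<Rightarrow> real"
    and f1 f2 :: "nat \<Rightarrow> coords \<Rightarrow> real"
    and h :: "nat \<Rightarrow> vfield"
  assumes graph: "pair_wf_digraph G" "pverts G = {1..n}"
    and path: "r \<ge> 2" "vpath (map i [1..<Suc r]) (with_proj G)"
    and indices: "\<And>k. k \<in> {1..r} \<Longrightarrow> j k \<in> index_set n p q (i k)"
    and C1: "\<And>k. k \<in> {1..<r} \<Longrightarrow>
          C1_on_prod (index_set n p q (j k)) (index_set n p q (j (Suc k))) (f k)"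
    and h_def: "\<And>k. k \<in> {1..<r} \<Longrightarrow> h k = edge_field n p q (j (Suc k)) (j k) (f k)"
    and factors: "\<And>k y w. k \<in> {1..<r} \<Longrightarrow> y \<in> coord_space (index_set n p q (j k)) \<Longrightarrow>
          w \<in> coord_space (index_set n p q (j (Suc k))) \<Longrightarrow> f k y w = f1 k y * f2 k w"
    and partial_ex: "\<And>k y. k \<in> {2..<r} \<Longrightarrow> y \<in> coord_space (index_set n p q (j k)) \<Longrightarrow>
          has_partial (f2 (k - 1)) (j k) y"
    and partial_one: "\<And>k y. k \<in> {2..<r} \<Longrightarrow> y \<in> coord_space (index_set n p q (j k)) \<Longrightarrow>
          f1 k y * partial (f2 (k - 1)) (j k) y = 1"
  shows "(\<forall>z\<in>coord_space {1..total_dim n p q}.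
            nested_bracket (total_dim n p q) (map h (rev [1..<r])) z =
            scaled_unit (total_dim n p q) (j 1)
              (f1 1 (restrict z (index_set n p q (j 1))) *
               f2 (r - 1) (restrict z (index_set n p q (j r)))))
       \<and> (\<forall>k\<in>{1..<r}. admissible G n p q (h k))"
proof -
  define N where "N = total_dim n p q"
  define A where "A k = agent_indices n p q (i k)" for k
  have "i ` {1..r} \<subseteq> {1..n}"
    using path(2) graph(2)
    by (simp add: vpath_def vwalk_def atLeastLessThanSuc_atLeastAtMost del: upt_Suc)
  then have agent: "i k \<in> {1..n}" if "k \<in> {1..r}" for k
    using that by blast
  have arc: "(i k, i (Suc k)) \<in> parcs G" if "k \<in> {1..<r}" for k
    using path(2) vwalk_arcs_map_upt[of 1 k r i] that
    by (auto simp: vpath_def vwalk_def arcs_ends_conv simp del: upt_Suc)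
  \<comment> \<open>Simplicity of the path enters here, as distinctness of its vertex list.\<close>
  have inj: "inj_on i {1..r}"
    using path(2) by (auto simp: vpath_def distinct_map atLeastLessThanSuc_atLeastAtMost simp del: upt_Suc)
  have jA: "j k \<in> A k" if "k \<in> {1..r}" for k
    using indices[OF that] index_set_agent[OF agent[OF that]] by (simp add: A_def)
  have IA: "index_set n p q (j k) = A k" if "k \<in> {1..r}" for k
    using index_set_eq jA agent that by (simp add: A_def)
  have jN: "j k \<in> {1..N}" if "k \<in> {1..r}" for k
    using jA[OF that] agent_indices_subset[OF agent[OF that]] unfolding A_def N_def by blast
  have notin: "j k \<notin> A l" if "k \<in> {1..r}" "l \<in> {1..r}" "k \<noteq> l" for k l
    using jA[OF that(1)] agent_indices_unique agent that inj unfolding A_def inj_on_def by blast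
  \<comment> \<open>This needs no carrier assumption on \<open>z\<close>: \<open>restrict\<close>
    always lands in the coordinate space of the block, so \<open>factors\<close> applies.\<close>
  have h: "h k z = scaled_unit N (j k) (f1 k (restrict z (A k)) * f2 k (restrict z (A (Suc k))))"
    if "k \<in> {1..<r}" for k z
    using that factors[OF that] by (simp add: h_def[OF that] edge_field_def N_def IA)
  \<comment> \<open>The list holds the fields \<open>h m\<close>, ..., \<open>h 1\<close>, outermost
    first; the last of the \<open>m\<close> arcs ends at position \<open>Suc m\<close>, hence the
    block \<open>A (Suc m)\<close>.\<close>
  have bracket: "nested_bracket N (map h (rev [1..<Suc m])) z =
      scaled_unit N (j 1) (f1 1 (restrict z (A 1)) * f2 m (restrict z (A (Suc m))))"
    if "1 \<le> m" "m < r" "z \<in> coord_space {1..N}" for m z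
    using that
  proof (induction m arbitrary: z rule: dec_induct)
    case base
    then show ?case
      using h[of 1 z] by (simp del: restrict_apply)
  next
    case (step m)
    let ?k = "Suc m"
    let ?B = "nested_bracket N (map h (rev [1..<Suc m]))"
    have k: "?k \<in> {2..<r}" "?k \<in> {1..r}" "Suc ?k \<in> {1..r}" and one: "1 \<in> {1..r}"
      using step by auto
    \<comment> \<open>Reversal puts the new field at the head, and \<open>1 \<le> m\<close> keeps
      the tail nonempty, so the recursive equation applies.\<close>
    have "nested_bracket N (map h (rev [1..<Suc ?k])) z = lie_bracket N (h ?k) ?B z"
      using step.hyps by simp
    also have "\<dots> = scaled_unit N (j 1)
        (partial (\<lambda>w. f1 1 (restrict w (A 1)) * f2 m (restrict w (A ?k))) (j ?k) z
         * (f1 ?k (restrict z (A ?k)) * f2 ?k (restrict z (A (Suc ?k)))))"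
    proof (rule lie_bracket_scaled_unit)
      \<comment> \<open>Since \<open>1 \<le> m\<close>, position 1 differs from both
        \<open>Suc m\<close> and \<open>Suc (Suc m)\<close>.\<close>
      show "partial (\<lambda>w. f1 ?k (restrict w (A ?k)) * f2 ?k (restrict w (A (Suc ?k)))) (j 1) z = 0"
        using notin[OF one k(2)] notin[OF one k(3)] step.hyps
        by (intro partial_restrict_notin[where g = "\<lambda>y w. f1 ?k y * f2 ?k w"]) auto
    qed (use step h jN one k in \<open>auto simp del: restrict_apply\<close>)
    also have "partial (\<lambda>w. f1 1 (restrict w (A 1)) * f2 m (restrict w (A ?k))) (j ?k) z
        = f1 1 (restrict z (A 1)) * partial (f2 m) (j ?k) (restrict z (A ?k))"
      \<comment> \<open>At index \<open>Suc m\<close> the hypothesis concerns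
        \<open>f2 (Suc m - 1)\<close>, which is \<open>f2 m\<close>.\<close>
      using partial_ex[OF k(1)] notin[OF k(2) one] jA[OF k(2)] step.hyps
      by (intro partial_mult_restrict) (auto simp: IA[OF k(2)])
    also have "\<dots> * (f1 ?k (restrict z (A ?k)) * f2 ?k (restrict z (A (Suc ?k))))
        = f1 1 (restrict z (A 1))
          * (f1 ?k (restrict z (A ?k)) * partial (f2 m) (j ?k) (restrict z (A ?k)))
          * f2 ?k (restrict z (A (Suc ?k)))"
      by (simp only: mult_ac)
    also have "f1 ?k (restrict z (A ?k)) * partial (f2 m) (j ?k) (restrict z (A ?k)) = 1"
      using partial_one[OF k(1)] by (simp add: IA[OF k(2)])
    finally show ?case
      by simp
  qed
  have "admissible G n p q (h k)" if "k \<in> {1..<r}" for k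
    using that arc agent jA unfolding h_def[OF that] A_def
    by (intro admissible_edge_field[where a = "i k" and b = "i (Suc k)"]) auto
  moreover have "nested_bracket N (map h (rev [1..<r])) z =
      scaled_unit N (j 1) (f1 1 (restrict z (A 1)) * f2 (r - 1) (restrict z (A r)))"
    if "z \<in> coord_space {1..N}" for z
    using bracket[of "r - 1" z] that path(1) by simp
  ultimately show ?thesis
    using path(1) by (simp add: N_def IA)
qed

end
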